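(* Not every maximal locally semisimple subalgebra of a finitary Lie algebra is a Levi component; that is, there exist a finitary Lie algebra $\mathfrak{q}$ over $\mathbb{C}$ and a maximal locally semisimple subalgebra $\mathfrak{l}$ of $\mathfrak{q}$ such that $\mathfrak{l}$ is not a Levi component of $\mathfrak{q}$.
   Context: All Lie algebras are over $\mathbb{C}$. A Lie algebra $\mathfrak{q}$ is finitary if it has a faithful countable-dimensional representation $\mathfrak{q}\hookrightarrow\mathrm{End}\,W$ such that $W$ has a basis in which the matrix of each endomorphism in the image of $\mathfrak{q}$ has only finitely many nonzero entries. A Lie algebra is locally finite if every finite subset lies in a finite-dimensional subalgebra (finitary Lie algebras are locally finite). A locally finite Lie algebra is locally solvable if every finite-dimensional subalgebra is solvable, and locally semisimple if it is the direct limit of a system of finite-dimensional semisimple subalgebras. A maximal locally semisimple subalgebra of $\mathfrak{q}$ is one that is maximal under inclusion among the locally semisimple subalgebras of $\mathfrak{q}$. Let $\mathfrak{r}$ be the locally solvable radical of $\mathfrak{q}$ (the largest locally solvable ideal). A subalgebra $\mathfrak{l}\subset\mathfrak{q}$ is a Levi component of $\mathfrak{q}$ if $[\mathfrak{q},\mathfrak{q}]$ is the semidirect sum of the ideal $\mathfrak{r}\cap[\mathfrak{q},\mathfrak{q}]$ and $\mathfrak{l}$ (i.e. $[\mathfrak{q},\mathfrak{q}]=(\mathfrak{r}\cap[\mathfrak{q},\mathfrak{q}])+\mathfrak{l}$ with zero intersection). *)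

theory Defs
  imports Complex_Main "HOL-Library.Countable_Set" "HOL-Library.Function_Algebras"
begin

text \<open>
  A complex Lie algebra is given by a carrier \<open>L\<close>, a subspace of some complex vector space
  (the type \<open>'a\<close> with scalar multiplication \<open>scale\<close>), and a bracket whose values outside
  \<open>L\<close> are irrelevant.
\<close>

locale lie_algebra = vector_space scale
  for scale :: "complex \<Rightarrow> 'a::ab_group_add \<Rightarrow> 'a" (infixr \<open>*s\<close> 75) +
  fixes L :: "'a set"
    and br :: "'a \<Rightarrow> 'a \<Rightarrow> 'a"
  assumes subspace_carrier: "subspace L"
    and br_closed: "x \<in> L \<Longrightarrow> y \<in> L \<Longrightarrow> br x y \<in> L"
    and br_add_left: "x \<in> L \<Longrightarrow> y \<in> L \<Longrightarrow> z \<in> L \<Longrightarrow> br (x + y) z = br x z + br y z"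
    and br_add_right: "x \<in> L \<Longrightarrow> y \<in> L \<Longrightarrow> z \<in> L \<Longrightarrow> br x (y + z) = br x y + br x z"
    and br_scale_left: "x \<in> L \<Longrightarrow> y \<in> L \<Longrightarrow> br (c *s x) y = c *s br x y"
    and br_scale_right: "x \<in> L \<Longrightarrow> y \<in> L \<Longrightarrow> br x (c *s y) = c *s br x y"
    and br_self: "x \<in> L \<Longrightarrow> br x x = 0"
    and jacobi: "x \<in> L \<Longrightarrow> y \<in> L \<Longrightarrow> z \<in> L \<Longrightarrow>
      br x (br y z) + br y (br z x) + br z (br x y) = 0"
begin

definition subalgebra :: "'a set \<Rightarrow> bool" where
  "subalgebra S \<longleftrightarrow> S \<subseteq> L \<and> subspace S \<and> (\<forall>x\<in>S. \<forall>y\<in>S. br x y \<in> S)"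

definition ideal_of :: "'a set \<Rightarrow> 'a set \<Rightarrow> bool" where
  "ideal_of I S \<longleftrightarrow> I \<subseteq> S \<and> subspace I \<and> (\<forall>x\<in>S. \<forall>y\<in>I. br x y \<in> I)"

definition derived :: "'a set \<Rightarrow> 'a set" where
  "derived S = span {br x y | x y. x \<in> S \<and> y \<in> S}"

definition solvable :: "'a set \<Rightarrow> bool" where
  "solvable S \<longleftrightarrow> (\<exists>n. (derived ^^ n) S = {0})"

definition finite_dim :: "'a set \<Rightarrow> bool" where
  "finite_dim S \<longleftrightarrow> (\<exists>B. finite B \<and> span B = S)"

text \<open>Semisimplicity means that the solvable radical vanishes; \<open>{0}\<close> counts as semisimple.\<close>

definition semisimple :: "'a set \<Rightarrow> bool" where
  "semisimple S \<longleftrightarrow> finite_dim S \<and> (\<forall>I. ideal_of I S \<and> solvable I \<longrightarrow> I = {0})"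

definition locally_finite :: "'a set \<Rightarrow> bool" where
  "locally_finite S \<longleftrightarrow>
     (\<forall>X. finite X \<and> X \<subseteq> S \<longrightarrow> (\<exists>F. subalgebra F \<and> finite_dim F \<and> X \<subseteq> F \<and> F \<subseteq> S))"

definition locally_solvable :: "'a set \<Rightarrow> bool" where
  "locally_solvable S \<longleftrightarrow>
     locally_finite S \<and> (\<forall>F. subalgebra F \<and> finite_dim F \<and> F \<subseteq> S \<longrightarrow> solvable F)"

text \<open>The direct limit of a directed system of subalgebras (with inclusions) is its union.\<close>

definition locally_semisimple :: "'a set \<Rightarrow> bool" where
  "locally_semisimple S \<longleftrightarrow>
     (\<exists>\<F>. \<F> \<noteq> {} \<and> (\<forall>F\<in>\<F>. subalgebra F \<and> semisimple F) \<and>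
          (\<forall>F\<in>\<F>. \<forall>G\<in>\<F>. \<exists>H\<in>\<F>. F \<subseteq> H \<and> G \<subseteq> H) \<and> \<Union>\<F> = S)"

definition maximal_locally_semisimple :: "'a set \<Rightarrow> bool" where
  "maximal_locally_semisimple S \<longleftrightarrow>
     subalgebra S \<and> locally_semisimple S \<and>
     (\<forall>T. subalgebra T \<and> locally_semisimple T \<and> S \<subseteq> T \<longrightarrow> T = S)"

definition locally_solvable_radical :: "'a set" where
  "locally_solvable_radical = (GREATEST R. ideal_of R L \<and> locally_solvable R)"

definition levi_component :: "'a set \<Rightarrow> bool" where
  "levi_component S \<longleftrightarrow> subalgebra S \<and>
     (let R = locally_solvable_radical \<inter> derived L in
        derived L = {r + s | r s. r \<in> R \<and> s \<in> S} \<and> R \<inter> S = {0})"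

end

text \<open>A faithful representation of \<open>L\<close> on the vector space with carrier \<open>W\<close>.\<close>

locale faithful_representation =
  lie_algebra scale L br + W: vector_space scaleW
  for scale :: "complex \<Rightarrow> 'a::ab_group_add \<Rightarrow> 'a" and L and br
    and scaleW :: "complex \<Rightarrow> 'w::ab_group_add \<Rightarrow> 'w" +
  fixes W :: "'w set"
    and \<rho> :: "'a \<Rightarrow> 'w \<Rightarrow> 'w"
  assumes subspace_W: "W.subspace W"
    and rep_closed: "x \<in> L \<Longrightarrow> w \<in> W \<Longrightarrow> \<rho> x w \<in> W"
    and rep_vec_add: "x \<in> L \<Longrightarrow> v \<in> W \<Longrightarrow> w \<in> W \<Longrightarrow> \<rho> x (v + w) = \<rho> x v + \<rho> x w"
    and rep_vec_scale: "x \<in> L \<Longrightarrow> w \<in> W \<Longrightarrow> \<rho> x (scaleW c w) = scaleW c (\<rho> x w)"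
    and rep_add: "x \<in> L \<Longrightarrow> y \<in> L \<Longrightarrow> w \<in> W \<Longrightarrow> \<rho> (x + y) w = \<rho> x w + \<rho> y w"
    and rep_scale: "x \<in> L \<Longrightarrow> w \<in> W \<Longrightarrow> \<rho> (scale c x) w = scaleW c (\<rho> x w)"
    and rep_br: "x \<in> L \<Longrightarrow> y \<in> L \<Longrightarrow> w \<in> W \<Longrightarrow>
      \<rho> (br x y) w = \<rho> x (\<rho> y w) - \<rho> y (\<rho> x w)"
    and faithful: "x \<in> L \<Longrightarrow> (\<And>w. w \<in> W \<Longrightarrow> \<rho> x w = 0) \<Longrightarrow> x = 0"
begin

text \<open>\<open>W.representation B (\<rho> x b) b'\<close> is the \<open>(b', b)\<close> entry of the matrix of \<open>\<rho> x\<close>.\<close>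

definition finitary_basis :: "'w set \<Rightarrow> bool" where
  "finitary_basis B \<longleftrightarrow>
     B \<subseteq> W \<and> W.independent B \<and> W.span B = W \<and>
     (\<forall>x\<in>L. finite {(b', b). b' \<in> B \<and> b \<in> B \<and> W.representation B (\<rho> x b) b' \<noteq> 0})"

end

text \<open>
  Every complex vector space of countable (finite or infinite) dimension is isomorphic to a
  subspace of \<open>nat \<Rightarrow> complex\<close>, so it is no restriction to take \<open>W\<close> inside that type.
\<close>

definition finitary_lie_algebra ::
    "(complex \<Rightarrow> 'a::ab_group_add \<Rightarrow> 'a) \<Rightarrow> 'a set \<Rightarrow> ('a \<Rightarrow> 'a \<Rightarrow> 'a) \<Rightarrow> bool" where
  "finitary_lie_algebra scale L br \<longleftrightarrow> lie_algebra scale L br \<and>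
     (\<exists>(scaleW :: complex \<Rightarrow> (nat \<Rightarrow> complex) \<Rightarrow> (nat \<Rightarrow> complex)) W \<rho> B.
        faithful_representation scale L br scaleW W \<rho> \<and> countable B \<and>
        faithful_representation.finitary_basis L scaleW W \<rho> B)"

end

theory Submission imports Defs begin

text \<open>
  Let \<open>X\<close> be the space of finitely supported complex sequences and let \<open>G\<close> be the space of eventually
  constant ones, so that \<open>X\<close> has codimension one in \<open>G\<close>. Finitely supported row vectors act as
  functionals on \<open>G\<close>, and none of them but zero vanishes on \<open>X\<close>: seen from these functionals, \<open>X\<close> is
  a dense hyperplane of \<open>G\<close>. The operators of finite rank built from the functionals and from vectors
  in \<open>G\<close>, respectively \<open>X\<close>, are the matrices with finitely many nonzero columns, all of them
  eventually constant, respectively the matrices with finitely many nonzero entries. They form the Lie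
  algebra \<open>gl_dense\<close>, respectively its subalgebra \<open>gl_fin\<close>; write \<open>sl(X) \<subset> sl(G)\<close> for their traceless parts.

  The counterexample is the Takiff-type algebra \<open>q = sl(G) + \<epsilon> gl(G)\<close> with \<open>\<epsilon>\<^sup>2 = 0\<close>. Its locally
  solvable radical is the abelian ideal \<open>\<epsilon> gl(G)\<close>, with quotient \<open>sl(G)\<close>. Let \<open>D\<close> be the commutator
  with the diagonal matrix with entries \<open>0, 1, 2, \<dots>\<close>. It is a derivation of \<open>gl_fin\<close>, but a matrix
  in \<open>gl_dense\<close> outside \<open>gl_fin\<close> has a column with nonzero eventual value, which \<open>D\<close> makes
  unbounded. Hence the twisted copy \<open>l = {x + \<epsilon> D x | x \<in> sl(X)}\<close> of \<open>sl(X)\<close> is a subalgebra of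
  \<open>q\<close>, and the formula that defines it does not extend to \<open>sl(G)\<close>.

  Suppose that \<open>T\<close> is a locally semisimple subalgebra containing \<open>l\<close>. It meets the abelian ideal
  \<open>\<epsilon> gl(G)\<close> only in zero. For \<open>y + \<epsilon> m\<close> in \<open>T\<close> and a matrix unit \<open>x = E\<^sub>p\<^sub>r\<close> whose row index \<open>p\<close> lies
  beyond the nonzero columns of \<open>y\<close> and \<open>m\<close>, the commutator \<open>[x, y]\<close> lies in \<open>sl(X)\<close>, so \<open>T\<close> contains
  both \<open>[x + \<epsilon> D x, y + \<epsilon> m]\<close> and \<open>[x, y] + \<epsilon> D [x, y]\<close>. Their difference is \<open>\<epsilon> [x, m - D y]\<close>,
  whence \<open>[x, m - D y] = 0\<close>. Varying \<open>p\<close> and \<open>r\<close> gives \<open>m = D y\<close>, and as \<open>D y\<close> now has eventually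
  constant columns, \<open>y\<close> is in \<open>sl(X)\<close>. So \<open>l\<close> is maximal (\<open>maximal_sl_fin\<close>). It is not a Levi
  component, because the derived algebra of \<open>q\<close> has elements \<open>y + \<epsilon> m\<close> with \<open>y\<close> outside
  \<open>gl_fin\<close>, and these are not in \<open>\<epsilon> gl(G) + l\<close> (\<open>not_levi\<close>).

  That \<open>l\<close> is locally semisimple, and that every locally solvable ideal of \<open>q\<close> lies in \<open>\<epsilon> gl(G)\<close>, both
  follow from one observation: an ideal with a suitable element contains, up to the \<open>\<epsilon>\<close>-component,
  two opposite matrix units and their commutator, and these keep reappearing in the derived series
  (\<open>sl2_triple_in_ideal\<close>, \<open>not_solvable_sl2\<close>).
\<close>

section \<open>Matrices with finitely many nonzero columns\<close>

text \<open>
  Finiteness of the set of nonzero columns makes all products finite sums, while it leaves room for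
  columns with infinitely many nonzero entries. The type is an associative ring without unit.
\<close>

typedef mat = "{x :: nat \<Rightarrow> nat \<Rightarrow> complex. \<exists>N. \<forall>i. \<forall>j\<ge>N. x i j = 0}"
  morphisms entry Mat
  by (rule exI[of _ "\<lambda>_ _. 0"]) simp

setup_lifting type_definition_mat

lemma mat_eqI: "(\<And>i j. entry x i j = entry y i j) \<Longrightarrow> x = y"
  by (metis entry_inject ext)

definition columns_below :: "nat \<Rightarrow> mat \<Rightarrow> bool" where
  "columns_below N x \<longleftrightarrow> (\<forall>i. \<forall>j\<ge>N. entry x i j = 0)"

lemma columns_below_exists: "\<exists>N. columns_below N x"
  using entry[of x] by (auto simp: columns_below_def)

lemma columns_below_mono: "columns_below N x \<Longrightarrow> N \<le> M \<Longrightarrow> columns_below M x"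
  by (auto simp: columns_below_def)

lemma columns_below_common:
  obtains N where "columns_below N x" "columns_below N y"
proof -
  obtain M K where "columns_below M x" "columns_below K y"
    using columns_below_exists by blast
  then show thesis
    using that[of "max M K"] columns_below_mono by (meson max.cobounded1 max.cobounded2)
qed

text \<open>
  The sum runs over the support of a row of \<open>x\<close>, which is finite; so \<open>act\<close> needs no bound on the
  columns as a parameter and is defined on arbitrary sequences.
\<close>

definition act :: "mat \<Rightarrow> (nat \<Rightarrow> complex) \<Rightarrow> nat \<Rightarrow> complex" where
  "act x v i = (\<Sum>k | entry x i k \<noteq> 0. entry x i k * v k)"

lemma act_eq: "columns_below N x \<Longrightarrow> act x v i = (\<Sum>k<N. entry x i k * v k)"
  unfolding act_def columns_below_def
  by (rule sum.mono_neutral_left) (auto simp: linorder_not_le[symmetric])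

instantiation mat :: ring
begin

lift_definition zero_mat :: mat is "\<lambda>_ _. 0" by simp

lift_definition plus_mat :: "mat \<Rightarrow> mat \<Rightarrow> mat" is "\<lambda>x y i j. x i j + y i j"
proof -
  fix x y :: "nat \<Rightarrow> nat \<Rightarrow> complex"
  assume "\<exists>N. \<forall>i. \<forall>j\<ge>N. x i j = 0" "\<exists>N. \<forall>i. \<forall>j\<ge>N. y i j = 0"
  then obtain N M where "\<forall>i. \<forall>j\<ge>N. x i j = 0" "\<forall>i. \<forall>j\<ge>M. y i j = 0" by blast
  then show "\<exists>N. \<forall>i. \<forall>j\<ge>N. x i j + y i j = 0"
    by (intro exI[of _ "max N M"]) simp
qed

lift_definition uminus_mat :: "mat \<Rightarrow> mat" is "\<lambda>x i j. - x i j" by simp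

definition minus_mat :: "mat \<Rightarrow> mat \<Rightarrow> mat" where "minus_mat x y = x + - y"

lift_definition times_mat :: "mat \<Rightarrow> mat \<Rightarrow> mat"
  is "\<lambda>x y i j. \<Sum>k | x i k \<noteq> 0. x i k * y k j"
proof -
  fix x y :: "nat \<Rightarrow> nat \<Rightarrow> complex"
  assume "\<exists>N. \<forall>i. \<forall>j\<ge>N. y i j = 0"
  then obtain N where "\<forall>i. \<forall>j\<ge>N. y i j = 0" ..
  then show "\<exists>N. \<forall>i. \<forall>j\<ge>N. (\<Sum>k | x i k \<noteq> 0. x i k * y k j) = 0"
    by (intro exI[of _ N]) simp
qed

lemma entry_zero: "entry 0 i j = 0" by transfer simp
lemma entry_plus: "entry (x + y) i j = entry x i j + entry y i j" by transfer simp
lemma entry_uminus: "entry (- x) i j = - entry x i j" by transfer simp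
lemma entry_minus: "entry (x - y) i j = entry x i j - entry y i j"
  by (simp add: minus_mat_def entry_plus entry_uminus)

lemma entry_times_act: "entry (x * y) i j = act x (\<lambda>k. entry y k j) i"
  unfolding act_def by transfer simp

lemma entry_times:
  "columns_below N x \<Longrightarrow> entry (x * y) i j = (\<Sum>k<N. entry x i k * entry y k j)"
  by (simp add: entry_times_act act_eq)

lemma columns_below_plus: "columns_below N x \<Longrightarrow> columns_below N y \<Longrightarrow> columns_below N (x + y)"
  by (auto simp: columns_below_def entry_plus)

lemma columns_below_times: "columns_below N y \<Longrightarrow> columns_below N (x * y)"
  by (auto simp: columns_below_def entry_times_act act_def)

lemma act_act: "act (x * y) v = act x (act y v)"
proof
  fix i
  obtain N where N: "columns_below N x" "columns_below N y" by (rule columns_below_common)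
  have "act (x * y) v i = (\<Sum>l<N. \<Sum>k<N. entry x i k * entry y k l * v l)"
    using N by (simp add: act_eq[OF columns_below_times] entry_times sum_distrib_right)
  also have "\<dots> = (\<Sum>k<N. \<Sum>l<N. entry x i k * entry y k l * v l)"
    by (rule sum.swap)
  also have "\<dots> = act x (act y v) i"
    using N by (simp add: act_eq sum_distrib_left mult.assoc)
  finally show "act (x * y) v i = act x (act y v) i" .
qed

instance
proof
  fix x y z :: mat
  show "x + y + z = x + (y + z)" by (rule mat_eqI) (simp add: entry_plus)
  show "x + y = y + x" by (rule mat_eqI) (simp add: entry_plus)
  show "0 + x = x" by (rule mat_eqI) (simp add: entry_plus entry_zero)
  show "- x + x = 0" by (rule mat_eqI) (simp add: entry_plus entry_zero entry_uminus)
  show "x - y = x + - y" by (rule minus_mat_def)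
  show "x * y * z = x * (y * z)"
    by (rule mat_eqI) (simp add: entry_times_act[of _ z] act_act, simp add: entry_times_act)
  show "(x + y) * z = x * z + y * z"
  proof (rule mat_eqI)
    fix i j
    obtain N where N: "columns_below N x" "columns_below N y" by (rule columns_below_common)
    show "entry ((x + y) * z) i j = entry (x * z + y * z) i j"
      using N by (simp add: entry_times[OF columns_below_plus] entry_times[of N] entry_plus
          sum.distrib algebra_simps)
  qed
  show "x * (y + z) = x * y + x * z"
  proof (rule mat_eqI)
    fix i j
    obtain N where N: "columns_below N x" using columns_below_exists by blast
    show "entry (x * (y + z)) i j = entry (x * y + x * z) i j"
      using N by (simp add: entry_times entry_plus sum.distrib algebra_simps)
  qed
qed

end

lemmas entry_simps = entry_zero entry_plus entry_uminus entry_minus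

lemma act_vec_add: "act x (v + w) = act x v + act x w"
  by (rule ext) (simp add: act_def sum.distrib algebra_simps)

lemma act_vec_scale: "act x (\<lambda>i. c * v i) = (\<lambda>i. c * act x v i)"
  by (rule ext) (simp add: act_def sum_distrib_left algebra_simps)

lemma act_add: "act (x + y) v = act x v + act y v"
proof
  fix i
  obtain N where N: "columns_below N x" "columns_below N y" by (rule columns_below_common)
  then show "act (x + y) v i = (act x v + act y v) i"
    by (simp add: act_eq[OF columns_below_plus] act_eq[of N] entry_plus sum.distrib algebra_simps)
qed

lift_definition scale_mat :: "complex \<Rightarrow> mat \<Rightarrow> mat" is "\<lambda>c x i j. c * x i j"
  by (metis mult_zero_right)

lemma entry_scale [simp]: "entry (scale_mat c x) i j = c * entry x i j" by transfer simp

lemma act_scale: "act (scale_mat c x) v = (\<lambda>i. c * act x v i)"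
proof
  fix i
  obtain N where N: "columns_below N x" using columns_below_exists by blast
  then have "columns_below N (scale_mat c x)" by (simp add: columns_below_def)
  with N show "act (scale_mat c x) v i = c * act x v i"
    by (simp add: act_eq sum_distrib_left algebra_simps)
qed

lemma act_minus: "act (x - y) v = act x v - act y v"
  using act_add[of "x - y" y v] by (simp add: eq_diff_eq)

lemma scale_times_left: "scale_mat c x * y = scale_mat c (x * y)"
  by (rule mat_eqI) (simp add: entry_times_act act_scale)

lemma scale_times_right: "x * scale_mat c y = scale_mat c (x * y)"
  by (rule mat_eqI) (simp add: entry_times_act act_vec_scale)

lemma scale_mat_add: "scale_mat c (x + y) = scale_mat c x + scale_mat c y"
  and scale_mat_minus: "scale_mat c (x - y) = scale_mat c x - scale_mat c y"
  and scale_mat_0 [simp]: "scale_mat c 0 = 0"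
  and scale_mat_1 [simp]: "scale_mat 1 x = x"
  and scale_mat_scale: "scale_mat a (scale_mat b x) = scale_mat (a * b) x"
  by (auto intro!: mat_eqI simp: entry_simps algebra_simps)

definition commutator :: "mat \<Rightarrow> mat \<Rightarrow> mat" where
  "commutator x y = x * y - y * x"

lift_definition unit_mat :: "nat \<Rightarrow> nat \<Rightarrow> mat"
  is "\<lambda>p r i j. if i = p \<and> j = r then 1 else 0"
  by (metis Suc_n_not_le_n)

lemma entry_unit_mat: "entry (unit_mat p r) i j = (if i = p \<and> j = r then 1 else 0)"
  by transfer simp

lemma entry_unit_times: "entry (unit_mat p r * x) i j = (if i = p then entry x r j else 0)"
proof -
  have "columns_below (Suc r) (unit_mat p r)" by (auto simp: columns_below_def entry_unit_mat)
  then show ?thesis by (auto simp: entry_times entry_unit_mat if_distrib[where f="\<lambda>u. u * _"] cong: if_cong)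
qed

lemma entry_times_unit: "entry (x * unit_mat p r) i j = (if j = r then entry x i p else 0)"
proof -
  obtain N where "columns_below N x" using columns_below_exists by blast
  then have "columns_below (max N (Suc p)) x" by (auto simp: columns_below_def)
  then show ?thesis by (auto simp: entry_times entry_unit_mat if_distrib[where f="\<lambda>u. _ * u"] cong: if_cong)
qed

lemma entry_commutator_unit:
  "entry (commutator (unit_mat p r) x) i j =
     (if i = p then entry x r j else 0) - (if j = r then entry x i p else 0)"
  by (simp add: commutator_def entry_simps entry_unit_times entry_times_unit)

definition trace :: "mat \<Rightarrow> complex" where
  "trace x = (\<Sum>i | entry x i i \<noteq> 0. entry x i i)"

lemma trace_eq: "columns_below N x \<Longrightarrow> trace x = (\<Sum>i<N. entry x i i)"
  unfolding trace_def columns_below_def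
  by (rule sum.mono_neutral_left) (auto simp: linorder_not_le[symmetric])

lemma trace_plus: "trace (x + y) = trace x + trace y"
proof -
  obtain N where N: "columns_below N x" "columns_below N y" by (rule columns_below_common)
  then show ?thesis
    by (simp add: trace_eq[OF columns_below_plus] trace_eq[of N] entry_plus sum.distrib)
qed

lemma trace_zero [simp]: "trace 0 = 0" by (simp add: trace_def entry_zero)

lemma trace_scale: "trace (scale_mat c x) = c * trace x"
proof -
  obtain N where N: "columns_below N x" using columns_below_exists by blast
  then have "columns_below N (scale_mat c x)" by (simp add: columns_below_def)
  with N show ?thesis by (simp add: trace_eq sum_distrib_left)
qed

lemma trace_commutator [simp]: "trace (commutator x y) = 0"
proof -
  obtain N where N: "columns_below N x" "columns_below N y" by (rule columns_below_common)
  have "trace (x * y) = (\<Sum>i<N. \<Sum>k<N. entry x i k * entry y k i)"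
    using N by (simp add: trace_eq[OF columns_below_times] entry_times)
  also have "\<dots> = (\<Sum>k<N. \<Sum>i<N. entry x i k * entry y k i)" by (rule sum.swap)
  also have "\<dots> = trace (y * x)"
    using N by (simp add: trace_eq[OF columns_below_times] entry_times mult.commute)
  finally have "trace (x * y) = trace (y * x)" .
  then show ?thesis
    using trace_plus[of "commutator x y" "y * x"] by (simp add: commutator_def)
qed

text \<open>
  The commutator with the infinite diagonal matrix with entries \<open>0, 1, 2, \<dots>\<close>, which is not
  itself of type \<^typ>\<open>mat\<close>. The factor \<open>i - j\<close> is unbounded along each column, so that a column
  with a nonzero eventual value loses its eventual constancy.
\<close>

lift_definition derivation :: "mat \<Rightarrow> mat" is "\<lambda>x i j. (of_nat i - of_nat j) * x i j"
  by (metis mult_zero_right)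

lemma entry_derivation:
  "entry (derivation x) i j = (of_nat i - of_nat j) * entry x i j"
  by transfer simp

lemma derivation_plus: "derivation (x + y) = derivation x + derivation y"
  and derivation_minus: "derivation (x - y) = derivation x - derivation y"
  and derivation_scale: "derivation (scale_mat c x) = scale_mat c (derivation x)"
  and derivation_zero [simp]: "derivation 0 = 0"
  by (auto intro!: mat_eqI simp: entry_simps entry_derivation algebra_simps)

lemma derivation_times: "derivation (x * y) = derivation x * y + x * derivation y"
proof (rule mat_eqI)
  fix i j
  obtain N where N: "columns_below N x" using columns_below_exists by blast
  then have N': "columns_below N (derivation x)"
    by (simp add: columns_below_def entry_derivation)
  show "entry (derivation (x * y)) i j = entry (derivation x * y + x * derivation y) i j"
    by (simp add: entry_plus entry_derivation entry_times[OF N] entry_times[OF N']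
        sum_distrib_left algebra_simps flip: sum.distrib sum_subtractf)
qed

lemma derivation_commutator:
  "derivation (commutator x y) = commutator (derivation x) y + commutator x (derivation y)"
  by (simp add: commutator_def derivation_minus derivation_times)


section \<open>The Takiff-type algebra of traceless matrices\<close>

lemma commutator_add_left: "commutator (x + y) z = commutator x z + commutator y z"
  and commutator_add_right: "commutator x (y + z) = commutator x y + commutator x z"
  and commutator_minus_right: "commutator x (y - z) = commutator x y - commutator x z"
  and commutator_zero_left [simp]: "commutator 0 x = 0"
  and commutator_zero_right [simp]: "commutator x 0 = 0"
  and commutator_anti: "commutator y x = - commutator x y"
  and commutator_scale_left: "commutator (scale_mat c x) y = scale_mat c (commutator x y)"
  and commutator_scale_right: "commutator x (scale_mat c y) = scale_mat c (commutator x y)"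
  by (simp_all add: commutator_def algebra_simps scale_times_left scale_times_right scale_mat_minus)

text \<open>
  The columns of a matrix in \<open>gl_dense\<close> are eventually constant sequences, those of a matrix in
  \<open>gl_fin\<close> are finitely supported. Since only finitely many columns are nonzero, one threshold \<open>N\<close>
  serves for all of them.
\<close>

definition gl_dense :: "mat set" where
  "gl_dense = {x. \<exists>v N. \<forall>i\<ge>N. \<forall>j. entry x i j = v j}"

definition gl_fin :: "mat set" where
  "gl_fin = {x. \<exists>N. \<forall>i\<ge>N. \<forall>j. entry x i j = 0}"

lemma gl_denseI: "\<forall>i\<ge>N. \<forall>j. entry x i j = v j \<Longrightarrow> x \<in> gl_dense"
  by (auto simp: gl_dense_def)

lemma gl_fin_subset: "gl_fin \<subseteq> gl_dense"
  by (auto simp: gl_fin_def intro: gl_denseI[where v="\<lambda>_. 0"])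

lemma gl_dense_zero: "0 \<in> gl_dense" by (auto simp: gl_dense_def entry_zero)

lemma gl_dense_add:
  assumes "x \<in> gl_dense" "y \<in> gl_dense" shows "x + y \<in> gl_dense"
proof -
  obtain N M v w where "\<forall>i\<ge>N. \<forall>j. entry x i j = v j" "\<forall>i\<ge>M. \<forall>j. entry y i j = w j"
    using assms by (auto simp: gl_dense_def)
  then have "\<forall>i\<ge>max N M. \<forall>j. entry (x + y) i j = v j + w j"
    by (simp add: entry_plus)
  then show ?thesis by (rule gl_denseI)
qed

lemma gl_dense_scale:
  assumes "x \<in> gl_dense" shows "scale_mat c x \<in> gl_dense"
proof -
  obtain N v where "\<forall>i\<ge>N. \<forall>j. entry x i j = v j" using assms by (auto simp: gl_dense_def)
  then have "\<forall>i\<ge>N. \<forall>j. entry (scale_mat c x) i j = c * v j" by simp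
  then show ?thesis by (rule gl_denseI)
qed

lemma gl_dense_minus: "x \<in> gl_dense \<Longrightarrow> y \<in> gl_dense \<Longrightarrow> x - y \<in> gl_dense"
proof -
  assume "x \<in> gl_dense" "y \<in> gl_dense"
  moreover have "x - y = x + scale_mat (- 1) y" by (rule mat_eqI) (simp add: entry_simps)
  ultimately show ?thesis by (simp only: gl_dense_add gl_dense_scale)
qed

text \<open>
  The value at \<open>i\<close> depends on \<open>x\<close> only through its \<open>i\<close>-th row, and far down all rows are equal. So
  \<open>x\<close> maps every sequence whatsoever to an eventually constant one.
\<close>

lemma act_gl_dense:
  assumes "x \<in> gl_dense" shows "\<exists>c N. \<forall>i\<ge>N. act x v i = c"
proof -
  obtain N r where "\<forall>i\<ge>N. \<forall>j. entry x i j = r j" using assms by (auto simp: gl_dense_def)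
  then have "\<forall>i\<ge>N. act x v i = (\<Sum>k | r k \<noteq> 0. r k * v k)" by (simp add: act_def)
  then show ?thesis by blast
qed

lemma gl_dense_times:
  assumes "x \<in> gl_dense" shows "x * y \<in> gl_dense"
proof -
  obtain N r where "\<forall>i\<ge>N. \<forall>j. entry x i j = r j" using assms by (auto simp: gl_dense_def)
  then have "\<forall>i\<ge>N. \<forall>j. entry (x * y) i j = (\<Sum>k | r k \<noteq> 0. r k * entry y k j)"
    by (simp add: entry_times_act act_def)
  then show ?thesis by (rule gl_denseI)
qed

lemma gl_dense_commutator: "x \<in> gl_dense \<Longrightarrow> y \<in> gl_dense \<Longrightarrow> commutator x y \<in> gl_dense"
  by (simp add: commutator_def gl_dense_minus gl_dense_times)

text \<open>
  The element \<open>x + \<epsilon> m\<close> is stored in a single infinite matrix, with the columns of \<open>x\<close> in the even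
  places and those of \<open>m\<close> in the odd places.
\<close>

definition pair :: "mat \<Rightarrow> mat \<Rightarrow> nat \<Rightarrow> nat \<Rightarrow> complex" where
  "pair x m i j = (if even j then entry x i (j div 2) else entry m i (j div 2))"

definition fst_mat :: "(nat \<Rightarrow> nat \<Rightarrow> complex) \<Rightarrow> mat" where
  "fst_mat z = Mat (\<lambda>i j. z i (2 * j))"

definition snd_mat :: "(nat \<Rightarrow> nat \<Rightarrow> complex) \<Rightarrow> mat" where
  "snd_mat z = Mat (\<lambda>i j. z i (2 * j + 1))"

lemma fst_mat_pair [simp]: "fst_mat (pair x m) = x"
  by (simp add: fst_mat_def pair_def entry_inverse)

lemma snd_mat_pair [simp]: "snd_mat (pair x m) = m"
  by (simp add: snd_mat_def pair_def entry_inverse)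

lemma pair_eq_iff [simp]: "pair x m = pair y n \<longleftrightarrow> x = y \<and> m = n"
  by (metis fst_mat_pair snd_mat_pair)

definition scale_fun :: "complex \<Rightarrow> (nat \<Rightarrow> nat \<Rightarrow> complex) \<Rightarrow> nat \<Rightarrow> nat \<Rightarrow> complex" where
  "scale_fun c z i j = c * z i j"

lemma pair_add: "pair x m + pair y n = pair (x + y) (m + n)"
  and pair_minus: "pair x m - pair y n = pair (x - y) (m - n)"
  and pair_scale: "scale_fun c (pair x m) = pair (scale_mat c x) (scale_mat c m)"
  and pair_zero: "pair 0 0 = 0"
  by (auto simp: fun_eq_iff pair_def entry_simps scale_fun_def)

lemma pair_eq_0_iff: "pair x m = 0 \<longleftrightarrow> x = 0 \<and> m = 0"
  by (metis pair_eq_iff pair_zero)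

lemma fst_mat_zero [simp]: "fst_mat 0 = 0" by (metis fst_mat_pair pair_zero)

definition takiff_bracket :: "(nat \<Rightarrow> nat \<Rightarrow> complex) \<Rightarrow> (nat \<Rightarrow> nat \<Rightarrow> complex) \<Rightarrow> nat \<Rightarrow> nat \<Rightarrow> complex" where
  "takiff_bracket z w = pair (commutator (fst_mat z) (fst_mat w))
     (commutator (fst_mat z) (snd_mat w) + commutator (snd_mat z) (fst_mat w))"

lemma bracket_pair [simp]:
  "takiff_bracket (pair x m) (pair y n) = pair (commutator x y) (commutator x n + commutator m y)"
  by (simp add: takiff_bracket_def)

lemma fst_mat_bracket [simp]: "fst_mat (takiff_bracket z w) = commutator (fst_mat z) (fst_mat w)"
  by (simp add: takiff_bracket_def)

text \<open>
  The first component is traceless so that it lies in a union of algebras \<open>sl(n)\<close>, rather than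
  \<open>gl(n)\<close>, as soon as it is finitely supported.
\<close>

definition takiff :: "(nat \<Rightarrow> nat \<Rightarrow> complex) set" where
  "takiff = {pair x m | x m. x \<in> gl_dense \<and> trace x = 0 \<and> m \<in> gl_dense}"

lemma pair_in_takiff [simp]:
  "pair x m \<in> takiff \<longleftrightarrow> x \<in> gl_dense \<and> trace x = 0 \<and> m \<in> gl_dense"
  by (auto simp: takiff_def)

lemma takiffE:
  assumes "z \<in> takiff"
  obtains x m where "z = pair x m" "x \<in> gl_dense" "trace x = 0" "m \<in> gl_dense"
  using assms by (auto simp: takiff_def)

interpretation VS: vector_space scale_fun
  by unfold_locales (auto simp: scale_fun_def fun_eq_iff algebra_simps)

interpretation Q: lie_algebra scale_fun takiff takiff_bracket
proof
  show "VS.subspace takiff"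
    by (rule VS.subspaceI)
      (auto simp: pair_add pair_scale gl_dense_add gl_dense_scale trace_plus trace_scale gl_dense_zero
        simp flip: pair_zero elim!: takiffE)
next
  fix x y assume "x \<in> takiff" "y \<in> takiff"
  then show "takiff_bracket x y \<in> takiff"
    by (auto elim!: takiffE simp: gl_dense_commutator gl_dense_add)
next
  fix x y z
  assume x: "x \<in> takiff" and y: "y \<in> takiff" and z: "z \<in> takiff"
  then show "takiff_bracket (x + y) z = takiff_bracket x z + takiff_bracket y z" "takiff_bracket x (y + z) = takiff_bracket x y + takiff_bracket x z"
    by (auto elim!: takiffE simp: pair_add commutator_add_left commutator_add_right)
next
  fix x y c
  assume x: "x \<in> takiff" and y: "y \<in> takiff"
  then show "takiff_bracket (scale_fun c x) y = scale_fun c (takiff_bracket x y)" "takiff_bracket x (scale_fun c y) = scale_fun c (takiff_bracket x y)"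
    by (auto elim!: takiffE simp: pair_scale commutator_scale_left commutator_scale_right scale_mat_add)
next
  fix x
  assume x: "x \<in> takiff"
  then show "takiff_bracket x x = 0"
    by (auto elim!: takiffE simp: pair_eq_0_iff commutator_def)
next
  fix x y z
  assume x: "x \<in> takiff" and y: "y \<in> takiff" and z: "z \<in> takiff"
  then show "takiff_bracket x (takiff_bracket y z) + takiff_bracket y (takiff_bracket z x) + takiff_bracket z (takiff_bracket x y) = 0"
    by (auto elim!: takiffE simp: pair_eq_0_iff pair_add commutator_def algebra_simps)
qed

section \<open>A faithful finitary representation\<close>

text \<open>
  The algebra acts on \<open>G \<oplus> G\<close>, where \<open>G\<close> is the space of eventually constant sequences, by the block
  matrices with diagonal blocks \<open>x\<close>, \<open>x\<close> and upper right block \<open>m\<close>. Pairs of sequences are again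
  stored by interleaving.
\<close>

definition vec_pair :: "(nat \<Rightarrow> complex) \<Rightarrow> (nat \<Rightarrow> complex) \<Rightarrow> nat \<Rightarrow> complex" where
  "vec_pair u v i = (if even i then u (i div 2) else v (i div 2))"

definition vec_fst :: "(nat \<Rightarrow> complex) \<Rightarrow> nat \<Rightarrow> complex" where "vec_fst w i = w (2 * i)"
definition vec_snd :: "(nat \<Rightarrow> complex) \<Rightarrow> nat \<Rightarrow> complex" where "vec_snd w i = w (2 * i + 1)"

lemma vec_fst_pair [simp]: "vec_fst (vec_pair u v) = u"
  and vec_snd_pair [simp]: "vec_snd (vec_pair u v) = v"
  by (auto simp: vec_fst_def vec_snd_def vec_pair_def fun_eq_iff)

definition scale_vec :: "complex \<Rightarrow> (nat \<Rightarrow> complex) \<Rightarrow> nat \<Rightarrow> complex" where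
  "scale_vec c w i = c * w i"

lemma vec_pair_add: "vec_pair u v + vec_pair u' v' = vec_pair (u + u') (v + v')"
  and vec_pair_minus: "vec_pair u v - vec_pair u' v' = vec_pair (u - u') (v - v')"
  and vec_pair_scale: "scale_vec c (vec_pair u v) = vec_pair (scale_vec c u) (scale_vec c v)"
  and vec_pair_zero: "vec_pair 0 0 = 0"
  by (auto simp: fun_eq_iff vec_pair_def scale_vec_def)

lemma vec_pair_eq_iff: "vec_pair u v = vec_pair u' v' \<longleftrightarrow> u = u' \<and> v = v'"
  by (metis vec_fst_pair vec_snd_pair)

lemma vec_fst_add: "vec_fst (v + w) = vec_fst v + vec_fst w"
  and vec_snd_add: "vec_snd (v + w) = vec_snd v + vec_snd w"
  and vec_fst_scale: "vec_fst (scale_vec c w) = scale_vec c (vec_fst w)"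
  and vec_snd_scale: "vec_snd (scale_vec c w) = scale_vec c (vec_snd w)"
  by (simp_all add: vec_fst_def vec_snd_def scale_vec_def fun_eq_iff)

lemma act_scale_vec: "act x (scale_vec c v) = scale_vec c (act x v)"
  and act_scale_mat: "act (scale_mat c x) v = scale_vec c (act x v)"
  by (simp_all add: scale_vec_def[abs_def] act_vec_scale act_scale)

definition takiff_rep :: "(nat \<Rightarrow> nat \<Rightarrow> complex) \<Rightarrow> (nat \<Rightarrow> complex) \<Rightarrow> nat \<Rightarrow> complex" where
  "takiff_rep z w = vec_pair (act (fst_mat z) (vec_fst w) + act (snd_mat z) (vec_snd w))
     (act (fst_mat z) (vec_snd w))"

lemma takiff_rep_pair [simp]: "takiff_rep (pair x m) (vec_pair u v) = vec_pair (act x u + act m v) (act x v)"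
  by (simp add: takiff_rep_def)

definition unit_vec :: "nat \<Rightarrow> nat \<Rightarrow> complex" where
  "unit_vec k i = (if i = k then 1 else 0)"

definition ones :: "nat \<Rightarrow> complex" where "ones i = 1"

definition eventually_const :: "(nat \<Rightarrow> complex) set" where
  "eventually_const = {u. \<exists>c N. \<forall>i\<ge>N. u i = c}"

text \<open>
  In the matrix of an operator with respect to this basis of \<open>G\<close>, an eventually constant column
  takes only finitely many entries: the constant sequence absorbs the infinite tail.
\<close>

definition gens :: "(nat \<Rightarrow> complex) set" where
  "gens = insert ones (range unit_vec)"

definition pair_gens :: "(nat \<Rightarrow> complex) set" where
  "pair_gens = (\<lambda>u. vec_pair u 0) ` gens \<union> (\<lambda>u. vec_pair 0 u) ` gens"

interpretation W: vector_space scale_vec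
  by unfold_locales (auto simp: scale_vec_def fun_eq_iff algebra_simps)

lemma act_unit_vec: "act x (unit_vec k) i = entry x i k"
proof -
  have "unit_vec k = (\<lambda>i. entry (unit_mat k 0) i 0)"
    by (auto simp: unit_vec_def entry_unit_mat)
  then show ?thesis
    by (simp add: entry_times_unit flip: entry_times_act)
qed

lemma eventually_const_span:
  assumes "u \<in> eventually_const"
  shows "u \<in> W.span gens"
proof -
  obtain c N where N: "\<forall>i\<ge>N. u i = c" using assms by (auto simp: eventually_const_def)
  have "u = scale_vec c ones + (\<Sum>k<N. scale_vec (u k - c) (unit_vec k))"
  proof
    fix i
    have "(\<Sum>k<N. scale_vec (u k - c) (unit_vec k)) i = (\<Sum>k<N. scale_vec (u k - c) (unit_vec k) i)"
      by (induction N) auto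
    also have "\<dots> = (if i < N then u i - c else 0)"
      by (auto simp: scale_vec_def unit_vec_def if_distrib[where f="\<lambda>u. _ * u"] cong: if_cong)
    finally show "u i = (scale_vec c ones + (\<Sum>k<N. scale_vec (u k - c) (unit_vec k))) i"
      using N by (auto simp: scale_vec_def ones_def)
  qed
  moreover have "scale_vec c ones + (\<Sum>k<N. scale_vec (u k - c) (unit_vec k)) \<in> W.span gens"
    by (intro W.span_add W.span_sum W.span_scale W.span_base) (auto simp: gens_def)
  ultimately show ?thesis by simp
qed

lemma vec_pair_span:
  assumes "u \<in> eventually_const" "v \<in> eventually_const"
  shows "vec_pair u v \<in> W.span pair_gens"
proof -
  have hom: "module_hom scale_vec scale_vec (\<lambda>u. vec_pair u 0)"
    "module_hom scale_vec scale_vec (\<lambda>u. vec_pair 0 u)"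
    by (unfold_locales; simp add: vec_pair_add vec_pair_scale; simp add: scale_vec_def fun_eq_iff vec_pair_def)+
  have "(\<lambda>u. vec_pair u 0) ` W.span gens \<subseteq> W.span pair_gens"
    unfolding module_hom.span_image[OF hom(1), symmetric]
    by (intro W.span_mono) (auto simp: pair_gens_def)
  moreover have "(\<lambda>u. vec_pair 0 u) ` W.span gens \<subseteq> W.span pair_gens"
    unfolding module_hom.span_image[OF hom(2), symmetric]
    by (intro W.span_mono) (auto simp: pair_gens_def)
  ultimately have "vec_pair u 0 \<in> W.span pair_gens" "vec_pair 0 v \<in> W.span pair_gens"
    using assms eventually_const_span by blast+
  then have "vec_pair u 0 + vec_pair 0 v \<in> W.span pair_gens" by (rule W.span_add)
  then show ?thesis by (simp add: vec_pair_add)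
qed

interpretation R: faithful_representation scale_fun takiff takiff_bracket scale_vec "W.span pair_gens" takiff_rep
proof
  show "W.subspace (W.span pair_gens)" by simp
next
  fix z w assume "z \<in> takiff"
  then obtain x m where z: "z = pair x m" "x \<in> gl_dense" "m \<in> gl_dense" by (rule takiffE)
  have ec: "act x u \<in> eventually_const" "act m u \<in> eventually_const"
     "act x u + act m v \<in> eventually_const" for u v
  proof -
    show "act x u \<in> eventually_const" "act m u \<in> eventually_const" for u
      using z act_gl_dense by (auto simp: eventually_const_def)
    then obtain N M b c where "\<forall>i\<ge>N. act x u i = b" "\<forall>i\<ge>M. act m v i = c"
      unfolding eventually_const_def by blast
    then have "\<forall>i\<ge>max N M. (act x u + act m v) i = b + c" by simp
    then show "act x u + act m v \<in> eventually_const" unfolding eventually_const_def by blast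
  qed
  show "takiff_rep z w \<in> W.span pair_gens"
    unfolding takiff_rep_def z by (intro vec_pair_span) (simp_all add: ec)
next
  fix z v w
  show "takiff_rep z (v + w) = takiff_rep z v + takiff_rep z w"
    by (simp add: takiff_rep_def vec_pair_add vec_fst_add vec_snd_add act_vec_add algebra_simps)
next
  fix z w c
  show "takiff_rep z (scale_vec c w) = scale_vec c (takiff_rep z w)"
    by (simp add: takiff_rep_def vec_pair_scale vec_fst_scale vec_snd_scale act_scale_vec W.scale_right_distrib)
next
  fix y z w assume "y \<in> takiff" "z \<in> takiff"
  then show "takiff_rep (y + z) w = takiff_rep y w + takiff_rep z w"
    by (auto elim!: takiffE simp: takiff_rep_def vec_pair_add pair_add act_add algebra_simps)
next
  fix z w c assume "z \<in> takiff"
  then show "takiff_rep (scale_fun c z) w = scale_vec c (takiff_rep z w)"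
    by (auto elim!: takiffE simp: takiff_rep_def vec_pair_scale pair_scale act_scale_mat W.scale_right_distrib)
next
  fix y z w assume "y \<in> takiff" "z \<in> takiff"
  then show "takiff_rep (takiff_bracket y z) w = takiff_rep y (takiff_rep z w) - takiff_rep z (takiff_rep y w)"
    by (auto elim!: takiffE simp: takiff_rep_def vec_pair_minus commutator_def act_add act_minus act_act act_vec_add vec_pair_eq_iff
          algebra_simps)
next
  fix z assume "z \<in> takiff" and 0: "\<And>w. w \<in> W.span pair_gens \<Longrightarrow> takiff_rep z w = 0"
  obtain x m where z: "z = pair x m" using \<open>z \<in> takiff\<close> by (rule takiffE)
  have "entry x i k = 0 \<and> entry m i k = 0" for i k
  proof -
    have "vec_pair 0 (unit_vec k) \<in> W.span pair_gens"
      by (rule W.span_base) (auto simp: pair_gens_def gens_def)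
    from 0[OF this] have "vec_pair (act x 0 + act m (unit_vec k)) (act x (unit_vec k)) = vec_pair 0 0"
      by (simp add: z vec_pair_zero)
    then have "act x 0 + act m (unit_vec k) = 0" "act x (unit_vec k) = 0"
      by (simp_all only: vec_pair_eq_iff)
    then have "act m (unit_vec k) i = 0" "act x (unit_vec k) i = 0"
      by (auto simp: fun_eq_iff act_def)
    then show ?thesis by (simp add: act_unit_vec)
  qed
  then show "z = 0"
    unfolding z pair_eq_0_iff by (auto intro!: mat_eqI simp: entry_zero)
qed

text \<open>
  Every vector has finitely many coordinates, so it suffices that each \<open>x + \<epsilon> m\<close> annihilates all but
  finitely many basis vectors, and it does annihilate the unit vectors beyond its nonzero columns. For
  this any basis contained in the given spanning set will do.
\<close>

lemma finitary_takiff: "finitary_lie_algebra scale_fun takiff takiff_bracket"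
proof -
  obtain B where B: "B \<subseteq> pair_gens" "W.independent B" "pair_gens \<subseteq> W.span B"
    using W.maximal_independent_subset by blast
  have "countable gens" by (simp add: gens_def)
  then have "countable pair_gens" by (simp add: pair_gens_def)
  then have cB: "countable B" using B(1) countable_subset by blast
  have spB: "W.span B = W.span pair_gens"
    using B by (meson W.span_eq W.span_superset subset_trans)
  have "finite {(b', b). b' \<in> B \<and> b \<in> B \<and> W.representation B (takiff_rep z b) b' \<noteq> 0}"
    if "z \<in> takiff" for z
  proof -
    obtain x m where z: "z = pair x m" using \<open>z \<in> takiff\<close> by (rule takiffE)
    obtain N where N: "columns_below N x" "columns_below N m" by (rule columns_below_common)
    let ?G = "insert ones (unit_vec ` {..<N})"
    define F where "F = (\<lambda>u. vec_pair u 0) ` ?G \<union> (\<lambda>u. vec_pair 0 u) ` ?G"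
    have "finite F" by (simp add: F_def)
    have vanish: "act x (unit_vec k) = 0" "act m (unit_vec k) = 0" if "k \<ge> N" for k
      using N that by (auto simp: fun_eq_iff act_unit_vec columns_below_def)
    have act0: "act y 0 = 0" for y by (auto simp: fun_eq_iff act_def)
    have "takiff_rep z b = 0" if "b \<in> B" "b \<notin> F" for b
    proof -
      have "b \<in> pair_gens" using that B by blast
      with that(2) obtain k where "k \<ge> N" "b = vec_pair (unit_vec k) 0 \<or> b = vec_pair 0 (unit_vec k)"
        unfolding pair_gens_def gens_def F_def by (auto simp: linorder_not_less[symmetric])
      then show ?thesis by (auto simp: z vanish act0 vec_pair_zero)
    qed
    then have "{(b', b). b' \<in> B \<and> b \<in> B \<and> W.representation B (takiff_rep z b) b' \<noteq> 0} \<subseteq>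
       (\<Union>b\<in>F. {b'. W.representation B (takiff_rep z b) b' \<noteq> 0} \<times> {b})"
      by (force simp: W.representation_zero)
    moreover have "finite \<dots>"
      using \<open>finite F\<close> by (intro finite_UN_I finite_cartesian_product W.finite_representation) auto
    ultimately show ?thesis by (rule finite_subset)
  qed
  then have "R.finitary_basis B"
    unfolding R.finitary_basis_def using B spB W.span_superset by blast
  then show ?thesis
    unfolding finitary_lie_algebra_def
    using Q.lie_algebra_axioms R.faithful_representation_axioms cB by blast
qed

section \<open>Three-dimensional simple subalgebras as obstructions to solvability\<close>

definition sl2_triple :: "nat \<Rightarrow> nat \<Rightarrow> mat set" where
  "sl2_triple p r = {unit_mat p r, unit_mat r p, commutator (unit_mat p r) (unit_mat r p)}"

lemma unit_mat_nonzero: "unit_mat p r \<noteq> 0"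
proof
  assume "unit_mat p r = 0"
  then have "entry (unit_mat p r) p r = 0" by (simp add: entry_zero)
  then show False by (simp add: entry_unit_mat)
qed

lemma sl2_relations:
  assumes "p \<noteq> r"
  defines "h \<equiv> commutator (unit_mat p r) (unit_mat r p)"
  shows "scale_mat (1/2) (commutator h (unit_mat p r)) = unit_mat p r"
    "scale_mat (-1/2) (commutator h (unit_mat r p)) = unit_mat r p"
  using assms(1) unfolding commutator_anti[of h]
  by (auto intro!: mat_eqI simp: entry_unit_mat h_def entry_commutator_unit entry_simps)

lemma commutator_unit_twice:
  assumes "p \<noteq> r"
  shows "commutator (unit_mat p r) (commutator (unit_mat p r) x) =
    scale_mat (- 2 * entry x r p) (unit_mat p r)"
  using assms by (auto intro!: mat_eqI simp: entry_commutator_unit entry_unit_mat)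

text \<open>
  The hypothesis on \<open>y\<close> says that its block with indices \<open>p\<close>, \<open>r\<close> is not upper triangular with equal
  diagonal entries. If the entry of \<open>y\<close> at \<open>(r, p)\<close> is nonzero, bracketing twice with the matrix unit
  at \<open>(p, r)\<close> produces a nonzero multiple of that unit. If it is zero, the diagonal entries differ,
  and one bracket moves their difference, up to sign, to the place \<open>(p, r)\<close>, to which the same argument applies with
  \<open>p\<close> and \<open>r\<close> exchanged. From one of the two units the other is obtained in the same way.
\<close>

lemma sl2_triple_in_ideal:
  assumes scale: "\<And>c x. x \<in> J \<Longrightarrow> scale_mat c x \<in> J"
    and pr: "\<And>x. x \<in> J \<Longrightarrow> commutator (unit_mat p r) x \<in> J"
    and rp: "\<And>x. x \<in> J \<Longrightarrow> commutator (unit_mat r p) x \<in> J"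
    and ne: "p \<noteq> r" and y: "y \<in> J" and nonscalar: "entry y r p \<noteq> 0 \<or> entry y p p \<noteq> entry y r r"
  shows "sl2_triple p r \<subseteq> J"
proof -
  have unit: "unit_mat a b \<in> J"
    if "a \<noteq> b" "\<And>x. x \<in> J \<Longrightarrow> commutator (unit_mat a b) x \<in> J" "x \<in> J" "entry x b a \<noteq> 0" for a b x
  proof -
    have "scale_mat (- 2 * entry x b a) (unit_mat a b) \<in> J"
      using that(2)[OF that(2)[OF that(3)]] by (simp only: commutator_unit_twice[OF that(1)])
    then have "scale_mat (1 / (- 2 * entry x b a)) (scale_mat (- 2 * entry x b a) (unit_mat a b)) \<in> J"
      by (rule scale)
    then show ?thesis using that(4) by (simp add: scale_mat_scale)
  qed
  have "unit_mat p r \<in> J \<or> unit_mat r p \<in> J"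
  proof (cases "entry y r p = 0")
    case False
    then show ?thesis using unit[OF ne pr y] by simp
  next
    case True
    then have "entry (commutator (unit_mat p r) y) p r \<noteq> 0"
      using nonscalar ne by (simp add: entry_commutator_unit)
    then show ?thesis using unit[OF ne[symmetric] rp pr[OF y]] by simp
  qed
  moreover have "unit_mat p r \<in> J" if "unit_mat r p \<in> J"
    using unit[OF ne pr that] by (simp add: entry_unit_mat)
  moreover have "unit_mat r p \<in> J" if "unit_mat p r \<in> J"
    using unit[OF ne[symmetric] rp that] by (simp add: entry_unit_mat)
  ultimately have "unit_mat p r \<in> J" "unit_mat r p \<in> J" by blast+
  then show ?thesis using pr by (auto simp: sl2_triple_def)
qed

text \<open>
  The three matrices are, up to nonzero scalars, commutators of each other; so they persist in every
  term of the derived series. It is enough to follow first components, because taking them is a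
  homomorphism.
\<close>

lemma not_solvable_sl2:
  assumes "p \<noteq> r" "sl2_triple p r \<subseteq> fst_mat ` S"
  shows "\<not> Q.solvable S"
proof
  assume "Q.solvable S"
  then obtain n where n: "(Q.derived ^^ n) S = {0}" by (auto simp: Q.solvable_def)
  have step: "sl2_triple p r \<subseteq> fst_mat ` Q.derived S'" if S': "sl2_triple p r \<subseteq> fst_mat ` S'" for S'
  proof -
    have br: "scale_mat c (commutator x y) \<in> fst_mat ` Q.derived S'"
      if xy: "x \<in> sl2_triple p r" "y \<in> sl2_triple p r" for c x y
    proof -
      obtain z w where zw: "z \<in> S'" "w \<in> S'" "x = fst_mat z" "y = fst_mat w" using xy S' by blast
      have "scale_fun c (takiff_bracket z w) \<in> Q.derived S'"
        unfolding Q.derived_def using zw by (intro VS.span_scale VS.span_base) auto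
      moreover have "fst_mat (scale_fun c (takiff_bracket z w)) = scale_mat c (commutator x y)"
        by (simp add: takiff_bracket_def pair_scale zw)
      ultimately show ?thesis by (metis imageI)
    qed
    show ?thesis
      using br[of "commutator (unit_mat p r) (unit_mat r p)" "unit_mat p r" "1/2"]
        br[of "commutator (unit_mat p r) (unit_mat r p)" "unit_mat r p" "-1/2"]
        br[of "unit_mat p r" "unit_mat r p" 1]
      unfolding sl2_relations[OF assms(1)] by (simp add: sl2_triple_def)
  qed
  have "sl2_triple p r \<subseteq> fst_mat ` (Q.derived ^^ n) S"
    by (induction n) (use assms(2) step in auto)
  then show False
    unfolding n using unit_mat_nonzero by (auto simp: sl2_triple_def)
qed

section \<open>The twisted copy of the traceless finitely supported matrices\<close>

definition twist :: "mat \<Rightarrow> nat \<Rightarrow> nat \<Rightarrow> complex" where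
  "twist x = pair x (derivation x)"

lemma twist_add: "twist (x + y) = twist x + twist y"
  and twist_scale: "twist (scale_mat c x) = scale_fun c (twist x)"
  and twist_zero: "twist 0 = 0"
  and bracket_twist: "takiff_bracket (twist x) (twist y) = twist (commutator x y)"
  by (simp_all add: twist_def pair_add pair_scale derivation_plus derivation_scale pair_zero
      derivation_commutator add.commute)

lemma fst_mat_twist [simp]: "fst_mat (twist x) = x" by (simp add: twist_def)

text \<open>
  The bracket is required to preserve \<open>I\<close> only for the twisted matrix units. As these lie both in the
  twisted copy and in the whole algebra, the lemma serves for ideals of either.
\<close>

lemma sl2_triple_in_fst_ideal:
  assumes I: "VS.subspace I" "I \<subseteq> takiff"
    and pr: "\<And>z. z \<in> I \<Longrightarrow> takiff_bracket (twist (unit_mat p r)) z \<in> I"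
    and rp: "\<And>z. z \<in> I \<Longrightarrow> takiff_bracket (twist (unit_mat r p)) z \<in> I"
    and ne: "p \<noteq> r" and y: "z \<in> I" and "fst_mat z = y"
    and "entry y r p \<noteq> 0 \<or> entry y p p \<noteq> entry y r r"
  shows "sl2_triple p r \<subseteq> fst_mat ` I"
proof (rule sl2_triple_in_ideal)
  show "scale_mat c x \<in> fst_mat ` I" if x: "x \<in> fst_mat ` I" for c x
  proof -
    obtain w where w: "w \<in> I" "x = fst_mat w" using x by blast
    then obtain m where "w = pair x m" using I(2) by (metis fst_mat_pair subsetD takiffE)
    then have "fst_mat (scale_fun c w) = scale_mat c x" by (simp add: pair_scale)
    moreover have "scale_fun c w \<in> I" using I(1) w(1) by (rule VS.subspace_scale)
    ultimately show ?thesis by (metis imageI)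
  qed
  show "commutator (unit_mat p r) x \<in> fst_mat ` I" if "x \<in> fst_mat ` I" for x
    using that pr by (metis (no_types, lifting) fst_mat_bracket fst_mat_twist image_iff)
  show "commutator (unit_mat r p) x \<in> fst_mat ` I" if "x \<in> fst_mat ` I" for x
    using that rp by (metis (no_types, lifting) fst_mat_bracket fst_mat_twist image_iff)
  show "y \<in> fst_mat ` I" using assms by blast
qed (use assms in auto)

definition sl_n :: "nat \<Rightarrow> mat set" where
  "sl_n n = {x. (\<forall>i j. i \<ge> n \<or> j \<ge> n \<longrightarrow> entry x i j = 0) \<and> trace x = 0}"

definition sl_fin :: "mat set" where
  "sl_fin = {x \<in> gl_fin. trace x = 0}"

lemma sl_n_mono: "n \<le> m \<Longrightarrow> sl_n n \<subseteq> sl_n m"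
  by (auto simp: sl_n_def)

lemma sl_fin_eq: "sl_fin = (\<Union>n. sl_n n)"
proof
  show "sl_fin \<subseteq> (\<Union>n. sl_n n)"
  proof
    fix x assume "x \<in> sl_fin"
    then obtain N where "\<forall>i\<ge>N. \<forall>j. entry x i j = 0" "trace x = 0" by (auto simp: sl_fin_def gl_fin_def)
    moreover obtain M where "columns_below M x" using columns_below_exists by blast
    ultimately have "x \<in> sl_n (max N M)" by (auto simp: sl_n_def columns_below_def)
    then show "x \<in> (\<Union>n. sl_n n)" by blast
  qed
  show "(\<Union>n. sl_n n) \<subseteq> sl_fin"
    by (auto simp: sl_n_def sl_fin_def gl_fin_def)
qed

lemma sl_n_closed:
  assumes "x \<in> sl_n n" "y \<in> sl_n n"
  shows "x + y \<in> sl_n n" "scale_mat c x \<in> sl_n n" "commutator x y \<in> sl_n n"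
proof -
  show "x + y \<in> sl_n n" "scale_mat c x \<in> sl_n n"
    using assms by (auto simp: sl_n_def entry_simps trace_plus trace_scale)
  have "columns_below n x" "columns_below n y" using assms by (auto simp: sl_n_def columns_below_def)
  then show "commutator x y \<in> sl_n n"
    using assms by (auto simp: sl_n_def entry_simps commutator_def entry_times trace_commutator[unfolded commutator_def])
qed

lemma unit_in_sl_n:
  assumes "p \<noteq> r" "p < n" "r < n" shows "unit_mat p r \<in> sl_n n"
proof -
  have "trace (unit_mat p r) = 0" using assms(1) by (auto simp: trace_def entry_unit_mat)
  then show ?thesis using assms by (auto simp: sl_n_def entry_unit_mat)
qed

lemma twist_sl_n_subset: "twist ` sl_n n \<subseteq> takiff"
proof
  fix z assume "z \<in> twist ` sl_n n"
  then obtain x where x: "x \<in> sl_n n" "z = twist x" by blast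
  then have "x \<in> gl_fin" "derivation x \<in> gl_fin"
    by (auto simp: sl_n_def gl_fin_def entry_derivation)
  then show "z \<in> takiff" using x gl_fin_subset by (auto simp: twist_def sl_n_def)
qed

lemma subalgebra_sl_n: "Q.subalgebra (twist ` sl_n n)"
  unfolding Q.subalgebra_def
proof (intro conjI ballI)
  show "twist ` sl_n n \<subseteq> takiff" by (rule twist_sl_n_subset)
  have 0: "0 \<in> sl_n n" by (simp add: sl_n_def entry_zero)
  show "VS.subspace (twist ` sl_n n)"
  proof (rule VS.subspaceI)
    show "0 \<in> twist ` sl_n n" using 0 twist_zero by (metis imageI)
  qed (auto simp: sl_n_closed simp flip: twist_add twist_scale)
  fix x y assume "x \<in> twist ` sl_n n" "y \<in> twist ` sl_n n"
  then show "takiff_bracket x y \<in> twist ` sl_n n" by (auto simp: bracket_twist sl_n_closed)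
qed

text \<open>
  The twisted matrix units span a space that contains the given one, though they need not lie in it
  (those on the diagonal do not); a basis is therefore chosen inside the smaller space.
\<close>

lemma finite_dim_sl_n: "Q.finite_dim (twist ` sl_n n)"
proof -
  let ?U = "(\<lambda>(i, j). twist (unit_mat i j)) ` ({..<n} \<times> {..<n})"
  have "twist ` sl_n n \<subseteq> VS.span ?U"
  proof
    fix z assume "z \<in> twist ` sl_n n"
    then obtain x where x: "x \<in> sl_n n" "z = twist x" by blast
    have entry_sum: "entry (sum f A) i j = (\<Sum>a\<in>A. entry (f a) i j)" if "finite A" for f :: "nat \<times> nat \<Rightarrow> mat" and A i j
      using that by (induction A) (auto simp: entry_simps)
    have twist_sum: "twist (sum f A) = (\<Sum>a\<in>A. twist (f a))" if "finite A" for f :: "nat \<times> nat \<Rightarrow> mat" and A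
      using that by (induction A) (auto simp: twist_zero twist_add)
    have "x = (\<Sum>a\<in>{..<n}\<times>{..<n}. scale_mat (entry x (fst a) (snd a)) (unit_mat (fst a) (snd a)))"
    proof (rule mat_eqI)
      fix i j
      have "(\<Sum>a\<in>{..<n}\<times>{..<n}. entry x (fst a) (snd a) * entry (unit_mat (fst a) (snd a)) i j)
        = (\<Sum>a\<in>{..<n}\<times>{..<n}. if a = (i, j) then entry x i j else 0)"
        by (rule sum.cong) (auto simp: entry_unit_mat)
      also have "\<dots> = entry x i j" using x by (auto simp: sl_n_def not_less)
      finally show "entry x i j = entry (\<Sum>a\<in>{..<n}\<times>{..<n}. scale_mat (entry x (fst a) (snd a)) (unit_mat (fst a) (snd a))) i j"
        by (simp add: entry_sum)
    qed
    then have "z = twist (\<Sum>a\<in>{..<n}\<times>{..<n}. scale_mat (entry x (fst a) (snd a)) (unit_mat (fst a) (snd a)))"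
      using x by simp
    also have "\<dots> \<in> VS.span ?U"
      by (simp only: twist_sum[OF finite_SigmaI] finite_lessThan twist_scale)
        (intro VS.span_sum VS.span_scale, rule VS.span_base, force)
    finally show "z \<in> VS.span ?U" .
  qed
  moreover have "VS.subspace (twist ` sl_n n)" using subalgebra_sl_n by (simp add: Q.subalgebra_def)
  moreover obtain B where B: "B \<subseteq> twist ` sl_n n" "VS.independent B" "twist ` sl_n n \<subseteq> VS.span B"
    using VS.maximal_independent_subset by blast
  ultimately have "B \<subseteq> VS.span ?U" "VS.span B = twist ` sl_n n"
    using VS.span_subspace[of B] by auto
  moreover from this B(2) have "finite B"
    using VS.independent_span_bound[of ?U B] by auto
  ultimately show ?thesis unfolding Q.finite_dim_def by blast
qed

text \<open>
  Otherwise \<open>x\<close> would be a multiple of the identity matrix of size \<open>n\<close>, and trace zero would force it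
  to vanish.
\<close>

lemma sl_n_nonscalar:
  assumes "x \<in> sl_n n" "x \<noteq> 0"
  shows "\<exists>p<n. \<exists>r<n. p \<noteq> r \<and> (entry x r p \<noteq> 0 \<or> entry x p p \<noteq> entry x r r)"
proof (rule ccontr)
  assume no: "\<not> ?thesis"
  have *: "entry x r p = 0 \<and> entry x p p = entry x r r" if "p \<noteq> r" "p < n" "r < n" for p r
    using that no by blast
  have "columns_below n x" using assms by (auto simp: sl_n_def columns_below_def)
  then have "(\<Sum>i<n. entry x i i) = 0" using assms by (simp add: sl_n_def flip: trace_eq)
  moreover have "(\<Sum>i<n. entry x i i) = (\<Sum>i<n. entry x 0 0)"
  proof (rule sum.cong)
    show "entry x i i = entry x 0 0" if "i \<in> {..<n}" for i
      using that *[of i 0] by (cases "i = 0") auto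
  qed simp
  ultimately have diag: "n = 0 \<or> entry x 0 0 = 0" by simp
  have "entry x i j = 0" for i j
  proof (cases "i < n \<and> j < n")
    case False
    then show ?thesis using assms(1) by (auto simp: sl_n_def not_less)
  next
    case True
    show ?thesis
    proof (cases "i = j")
      case True
      have "entry x i i = entry x 0 0" using \<open>i < n \<and> j < n\<close> *[of i 0] by (cases "i = 0") auto
      then show ?thesis using True \<open>i < n \<and> j < n\<close> diag by auto
    qed (use \<open>i < n \<and> j < n\<close> *[of j i] in auto)
  qed
  then show False using assms(2) by (auto intro: mat_eqI simp: entry_zero)
qed

text \<open>
  A nonzero ideal contains a nonscalar matrix, hence matrices that prevent solvability.
\<close>

lemma semisimple_sl_n: "Q.semisimple (twist ` sl_n n)"
  unfolding Q.semisimple_def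
proof (intro conjI allI impI)
  show "Q.finite_dim (twist ` sl_n n)" by (rule finite_dim_sl_n)
  fix I assume "Q.ideal_of I (twist ` sl_n n) \<and> Q.solvable I"
  then have I: "I \<subseteq> twist ` sl_n n" "VS.subspace I" "\<And>x y. x \<in> twist ` sl_n n \<Longrightarrow> y \<in> I \<Longrightarrow> takiff_bracket x y \<in> I"
    and solv: "Q.solvable I" by (auto simp: Q.ideal_of_def)
  have "z = 0" if "z \<in> I" for z
  proof (rule ccontr)
    assume "z \<noteq> 0"
    obtain x where x: "x \<in> sl_n n" "z = twist x" using I(1) \<open>z \<in> I\<close> by blast
    with \<open>z \<noteq> 0\<close> have "x \<noteq> 0" by (auto simp: twist_zero)
    from sl_n_nonscalar[OF x(1) this]
    obtain p r where pr: "p \<noteq> r" "p < n" "r < n" "entry x r p \<noteq> 0 \<or> entry x p p \<noteq> entry x r r"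
      by blast
    have "sl2_triple p r \<subseteq> fst_mat ` I"
    proof (rule sl2_triple_in_fst_ideal)
      show "I \<subseteq> takiff" using I(1) twist_sl_n_subset by blast
      show "fst_mat z = x" by (simp add: x)
    qed (use I pr that unit_in_sl_n in auto)
    then show False using not_solvable_sl2 pr(1) solv by blast
  qed
  then show "I = {0}" using VS.subspace_0[OF I(2)] by blast
qed

lemma sl_fin_image: "twist ` sl_fin = (\<Union>n. twist ` sl_n n)"
  by (auto simp: sl_fin_eq)

lemma twist_sl_n_directed: "\<exists>H\<in>range (\<lambda>n. twist ` sl_n n). twist ` sl_n a \<subseteq> H \<and> twist ` sl_n b \<subseteq> H"
  by (intro bexI[of _ "twist ` sl_n (max a b)"] conjI image_mono sl_n_mono) auto

lemma locally_semisimple_sl_fin: "Q.locally_semisimple (twist ` sl_fin)"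
  unfolding Q.locally_semisimple_def
  by (rule exI[of _ "range (\<lambda>n. twist ` sl_n n)"])
    (use twist_sl_n_directed in \<open>auto simp: subalgebra_sl_n semisimple_sl_n sl_fin_eq\<close>)

lemma subalgebra_sl_fin: "Q.subalgebra (twist ` sl_fin)"
proof -
  have common: "\<exists>n. x \<in> twist ` sl_n n \<and> y \<in> twist ` sl_n n"
    if "x \<in> twist ` sl_fin" "y \<in> twist ` sl_fin" for x y
    using that twist_sl_n_directed unfolding sl_fin_image by blast
  have sub: "Q.subalgebra (twist ` sl_n n)" for n by (rule subalgebra_sl_n)
  show ?thesis
    unfolding Q.subalgebra_def
  proof (intro conjI ballI VS.subspaceI)
    show "twist ` sl_fin \<subseteq> takiff" unfolding sl_fin_image using twist_sl_n_subset by blast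
    show "0 \<in> twist ` sl_fin" unfolding sl_fin_image
      using sub[of 0] VS.subspace_0[of "twist ` sl_n 0"] unfolding Q.subalgebra_def by blast
    fix x y assume "x \<in> twist ` sl_fin" "y \<in> twist ` sl_fin"
    then obtain n where "x \<in> twist ` sl_n n" "y \<in> twist ` sl_n n" using common by blast
    then have "x + y \<in> twist ` sl_n n" "takiff_bracket x y \<in> twist ` sl_n n"
      using sub[of n] VS.subspace_add by (auto simp: Q.subalgebra_def)
    then show "x + y \<in> twist ` sl_fin" "takiff_bracket x y \<in> twist ` sl_fin" unfolding sl_fin_image by blast+
  next
    fix x c assume "x \<in> twist ` sl_fin"
    then obtain n where "x \<in> twist ` sl_n n" unfolding sl_fin_image by blast
    then have "scale_fun c x \<in> twist ` sl_n n"
      using sub[of n] VS.subspace_scale unfolding Q.subalgebra_def by blast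
    then show "scale_fun c x \<in> twist ` sl_fin" unfolding sl_fin_image by blast
  qed
qed

section \<open>Maximality of the twisted copy\<close>

definition eps_ideal :: "(nat \<Rightarrow> nat \<Rightarrow> complex) set" where
  "eps_ideal = pair 0 ` gl_dense"

lemma eps_ideal_subspace: "VS.subspace eps_ideal"
proof (rule VS.subspaceI)
  show "0 \<in> eps_ideal" using gl_dense_zero by (force simp: eps_ideal_def simp flip: pair_zero)
qed (auto simp: eps_ideal_def pair_add pair_scale gl_dense_add gl_dense_scale)

lemma eps_ideal_bracket: "x \<in> eps_ideal \<Longrightarrow> y \<in> eps_ideal \<Longrightarrow> takiff_bracket x y = 0"
  by (auto simp: eps_ideal_def pair_zero)

lemma eps_ideal_is_ideal: "Q.ideal_of eps_ideal takiff"
  unfolding Q.ideal_of_def using eps_ideal_subspace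
  by (auto simp: eps_ideal_def gl_dense_zero gl_dense_commutator elim!: takiffE)

lemma solvable_in_eps_ideal:
  assumes "VS.subspace I" "I \<subseteq> eps_ideal" shows "Q.solvable I"
proof -
  have "takiff_bracket x y = 0" if "x \<in> I" "y \<in> I" for x y
    using that assms(2) by (intro eps_ideal_bracket) auto
  then have "{takiff_bracket x y | x y. x \<in> I \<and> y \<in> I} \<subseteq> {0}" by auto
  then have "Q.derived I \<subseteq> VS.span {0}" unfolding Q.derived_def by (rule VS.span_mono)
  moreover have "0 \<in> Q.derived I" unfolding Q.derived_def by (rule VS.span_zero)
  ultimately have "Q.derived I = {0}" by auto
  then show ?thesis unfolding Q.solvable_def by (intro exI[of _ 1]) simp
qed

text \<open>
  The ideal cuts out an abelian ideal in every member of a directed system of semisimple subalgebras.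
\<close>

lemma locally_semisimple_Int_eps:
  assumes "Q.locally_semisimple T" "z \<in> T" "z \<in> eps_ideal" shows "z = 0"
proof -
  obtain F where F: "Q.subalgebra F" "Q.semisimple F" "z \<in> F"
    using assms unfolding Q.locally_semisimple_def by blast
  have "Q.ideal_of (F \<inter> eps_ideal) F"
    using F(1) eps_ideal_is_ideal VS.subspace_inter[of F eps_ideal]
    unfolding Q.ideal_of_def Q.subalgebra_def by auto
  moreover have "Q.solvable (F \<inter> eps_ideal)"
    using F(1) eps_ideal_subspace VS.subspace_inter
    by (intro solvable_in_eps_ideal) (auto simp: Q.subalgebra_def)
  ultimately have "F \<inter> eps_ideal = {0}" using F(2) by (simp add: Q.semisimple_def)
  then show ?thesis using F assms by blast
qed

text \<open>
  Every element \<open>y + \<epsilon> m\<close> of a larger locally semisimple subalgebra is compared with the value that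
  \<open>m\<close> would have in the twisted copy, namely \<open>derivation y\<close>. The defect \<open>n\<close> commutes with enough matrix
  units to vanish, and then \<open>y\<close> and \<open>derivation y\<close> both have eventually constant columns, which is
  possible for finitely supported \<open>y\<close> only.
\<close>

lemma maximal_sl_fin: "Q.maximal_locally_semisimple (twist ` sl_fin)"
  unfolding Q.maximal_locally_semisimple_def
proof (intro conjI allI impI)
  show "Q.subalgebra (twist ` sl_fin)" by (rule subalgebra_sl_fin)
  show "Q.locally_semisimple (twist ` sl_fin)" by (rule locally_semisimple_sl_fin)
  fix T assume "Q.subalgebra T \<and> Q.locally_semisimple T \<and> twist ` sl_fin \<subseteq> T"
  then have sub: "T \<subseteq> takiff" "VS.subspace T" "\<And>x y. x \<in> T \<Longrightarrow> y \<in> T \<Longrightarrow> takiff_bracket x y \<in> T"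
    and ls: "Q.locally_semisimple T" and T: "twist ` sl_fin \<subseteq> T" by (auto simp: Q.subalgebra_def)
  have "z \<in> twist ` sl_fin" if "z \<in> T" for z
  proof -
    have "z \<in> takiff" using sub(1) that by blast
    then obtain y m where z: "z = pair y m" "y \<in> gl_dense" "trace y = 0" "m \<in> gl_dense"
      by (rule takiffE)
    define n where "n = m - derivation y"
    obtain N where N: "columns_below N y" "columns_below N m" by (rule columns_below_common)
    have key: "commutator (unit_mat p r) n = 0" if p: "p \<ge> N" "p \<noteq> r" for p r
    proof -
      let ?x = "unit_mat p r"
      have x: "?x \<in> sl_fin"
        unfolding sl_fin_eq using p unit_in_sl_n[of p r "Suc (max p r)"] by (intro UN_I[of "Suc (max p r)"]) auto
      \<comment> \<open>Row \<open>p\<close> of \<open>[x, y]\<close> is row \<open>r\<close> of \<open>y\<close>; the other term involves column \<open>p\<close> of \<open>y\<close>, which is zero.\<close>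
      have "entry (commutator ?x y) i j = 0" if "i \<ge> Suc p" for i j
        using that N p by (auto simp: entry_commutator_unit columns_below_def)
      then have xy: "commutator ?x y \<in> sl_fin" by (auto simp: sl_fin_def gl_fin_def)
      have "takiff_bracket (twist ?x) z - twist (commutator ?x y) \<in> T"
        using sub T x xy \<open>z \<in> T\<close> by (intro VS.subspace_diff) auto
      moreover have "takiff_bracket (twist ?x) z - twist (commutator ?x y) = pair 0 (commutator ?x n)"
        by (simp add: twist_def z pair_minus derivation_commutator n_def commutator_minus_right)
      moreover have "commutator ?x n \<in> gl_dense"
        using calculation sub(1) by auto
      ultimately have "pair 0 (commutator ?x n) = 0"
        using ls by (intro locally_semisimple_Int_eps) (auto simp: eps_ideal_def)
      then show ?thesis by (simp add: pair_eq_0_iff)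
    qed
    \<comment> \<open>Row \<open>p\<close> of \<open>[E, n]\<close>, for the matrix unit \<open>E\<close> at \<open>(p, r)\<close>, is row \<open>r\<close> of \<open>n\<close>.\<close>
    have "entry n r j = 0" for r j
    proof -
      define p where "p = max N (Suc r)"
      have "entry (commutator (unit_mat p r) n) p j = 0"
        using key[of p r] by (simp add: p_def entry_zero)
      moreover have "entry n p p = 0" using N by (simp add: n_def columns_below_def p_def entry_simps entry_derivation)
      ultimately show ?thesis by (auto simp: entry_commutator_unit split: if_splits)
    qed
    then have "n = 0" by (auto intro!: mat_eqI simp: entry_zero)
    then have m: "m = derivation y" by (simp add: n_def)
    obtain a w where w: "\<forall>i\<ge>a. \<forall>j. entry y i j = w j" using z(2) by (auto simp: gl_dense_def)
    obtain b w' where w': "\<forall>i\<ge>b. \<forall>j. entry (derivation y) i j = w' j"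
      using z(4) unfolding m gl_dense_def by blast
    \<comment> \<open>In two successive rows the factor \<open>i - j\<close> differs by one, while the product is the same.\<close>
    have "w j = 0" for j
    proof -
      define i where "i = max a b"
      have "(of_nat i - of_nat j) * w j = w' j" "(of_nat (Suc i) - of_nat j) * w j = w' j"
        using w w'[rule_format, of i j] w'[rule_format, of "Suc i" j]
        by (auto simp: entry_derivation i_def)
      then have "(of_nat (Suc i) - of_nat j) * w j - (of_nat i - of_nat j) * w j = 0" by simp
      then show ?thesis by (simp add: algebra_simps)
    qed
    then have "y \<in> sl_fin" using w z(3) by (auto simp: sl_fin_def gl_fin_def)
    then show ?thesis unfolding z m twist_def by blast
  qed
  then show "T = twist ` sl_fin" using T by blast
qed

section \<open>The radical and the failure of the Levi property\<close>

lemma locally_solvable_eps: "Q.locally_solvable eps_ideal"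
  unfolding Q.locally_solvable_def Q.locally_finite_def
proof (intro conjI allI impI)
  fix X assume X: "finite X \<and> X \<subseteq> eps_ideal"
  let ?F = "VS.span X"
  have F: "?F \<subseteq> eps_ideal" using X eps_ideal_subspace by (simp add: VS.span_minimal)
  have "takiff_bracket x y \<in> ?F" if "x \<in> ?F" "y \<in> ?F" for x y
    using that F eps_ideal_bracket VS.span_zero by (metis subsetD)
  then have "Q.subalgebra ?F"
    using F eps_ideal_is_ideal unfolding Q.subalgebra_def Q.ideal_of_def by auto
  moreover have "Q.finite_dim ?F" using X unfolding Q.finite_dim_def by blast
  ultimately show "\<exists>F. Q.subalgebra F \<and> Q.finite_dim F \<and> X \<subseteq> F \<and> F \<subseteq> eps_ideal"
    using F VS.span_superset by blast
next
  fix F assume "Q.subalgebra F \<and> Q.finite_dim F \<and> F \<subseteq> eps_ideal"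
  then show "Q.solvable F" by (intro solvable_in_eps_ideal) (auto simp: Q.subalgebra_def)
qed

text \<open>
  There are no nonzero scalar matrices here: far along the diagonal all entries are zero.
\<close>

lemma gl_dense_nonscalar:
  assumes "x \<noteq> 0"
  obtains p r where "p \<noteq> r" "entry x r p \<noteq> 0 \<or> entry x p p \<noteq> entry x r r"
proof -
  obtain i j where ij: "entry x i j \<noteq> 0" using assms by (metis entry_zero mat_eqI)
  obtain N where N: "columns_below N x" using columns_below_exists by blast
  show thesis
  proof (cases "i = j")
    case True
    then show thesis using that[of i "max N (Suc i)"] ij N by (auto simp: columns_below_def)
  next
    case False
    then show thesis using that[of j i] ij by auto
  qed
qed

text \<open>
  An ideal with an element outside the \<open>\<epsilon>\<close>-part contains lifts of a simple three-dimensional algebra.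
  The lifts need not span a subalgebra, but by local finiteness they lie in a finite-dimensional one,
  which cannot be solvable.
\<close>

lemma locally_solvable_ideal_subset:
  assumes "Q.ideal_of I takiff" "Q.locally_solvable I" shows "I \<subseteq> eps_ideal"
proof
  fix z assume "z \<in> I"
  have I: "I \<subseteq> takiff" "VS.subspace I" "\<And>x y. x \<in> takiff \<Longrightarrow> y \<in> I \<Longrightarrow> takiff_bracket x y \<in> I"
    using assms(1) by (auto simp: Q.ideal_of_def)
  have "z \<in> takiff" using I(1) \<open>z \<in> I\<close> by blast
  then obtain y m where z: "z = pair y m" "m \<in> gl_dense" by (rule takiffE)
  have "y = 0"
  proof (rule ccontr)
    assume "y \<noteq> 0"
    then obtain p r where pr: "p \<noteq> r" "entry y r p \<noteq> 0 \<or> entry y p p \<noteq> entry y r r"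
      by (rule gl_dense_nonscalar)
    have unit: "twist (unit_mat a b) \<in> takiff" if "a \<noteq> b" for a b
      using unit_in_sl_n[OF that, of "Suc (max a b)"]
      by (intro subsetD[OF twist_sl_n_subset[of "Suc (max a b)"]] imageI) simp
    have "sl2_triple p r \<subseteq> fst_mat ` I"
      by (rule sl2_triple_in_fst_ideal) (use I pr z \<open>z \<in> I\<close> unit in auto)
    then obtain X where X: "X \<subseteq> I" "finite X" "fst_mat ` X = sl2_triple p r"
      by (metis finite_subset_image finite.emptyI finite.insertI sl2_triple_def)
    then obtain F where F: "Q.subalgebra F" "Q.finite_dim F" "X \<subseteq> F" "F \<subseteq> I"
      using assms(2) unfolding Q.locally_solvable_def Q.locally_finite_def by meson
    then have "Q.solvable F" using assms(2) unfolding Q.locally_solvable_def by blast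
    moreover have "sl2_triple p r \<subseteq> fst_mat ` F" using X F by blast
    ultimately show False using not_solvable_sl2 pr(1) by blast
  qed
  then show "z \<in> eps_ideal" using z by (auto simp: eps_ideal_def)
qed

lemma radical_eq: "Q.locally_solvable_radical = eps_ideal"
  unfolding Q.locally_solvable_radical_def
  by (rule Greatest_equality) (auto simp: eps_ideal_is_ideal locally_solvable_eps dest: locally_solvable_ideal_subset)

text \<open>
  The matrix \<open>g\<close>, with columns \<open>1\<close>, \<open>-1\<close>, \<open>0\<close>, \<open>0\<close>, \<open>\<dots>\<close>, is traceless. Its commutator with the matrix
  unit at \<open>(0, 1)\<close> has the entry \<open>-1\<close> in column \<open>1\<close> of every row but the first, so it is not finitely
  supported. Yet the sum of the radical and the twisted copy has only finitely supported first
  components.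
\<close>

lemma not_levi: "\<not> Q.levi_component (twist ` sl_fin)"
proof
  assume levi: "Q.levi_component (twist ` sl_fin)"
  define g where "g = Mat (\<lambda>i j. if j = 0 then 1 else if j = 1 then - 1 else 0)"
  have g: "entry g i j = (if j = 0 then 1 else if j = 1 then - 1 else 0)" for i j
    unfolding g_def by (subst Mat_inverse) (auto intro!: exI[of _ 2])
  have "columns_below 2 g" by (auto simp: columns_below_def g)
  then have "trace g = 0" by (simp add: trace_eq g numeral_2_eq_2)
  moreover have "g \<in> gl_dense"
    by (rule gl_denseI[of 0 _ "\<lambda>j. if j = 0 then 1 else if j = 1 then - 1 else 0"]) (simp add: g)
  ultimately have gq: "pair g 0 \<in> takiff" by (simp add: gl_dense_zero)
  have uq: "twist (unit_mat 0 1) \<in> takiff"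
    using twist_sl_n_subset unit_in_sl_n[of 0 1 2] by auto
  have "takiff_bracket (twist (unit_mat 0 1)) (pair g 0) \<in> Q.derived takiff"
    unfolding Q.derived_def using gq uq by (intro VS.span_base) blast
  then obtain r s where rs: "takiff_bracket (twist (unit_mat 0 1)) (pair g 0) = r + s" "r \<in> eps_ideal" "s \<in> twist ` sl_fin"
    using levi unfolding Q.levi_component_def Let_def radical_eq by blast
  then obtain x m where "r = pair 0 m" "s = twist x" "x \<in> sl_fin" by (auto simp: eps_ideal_def)
  with rs(1) have "commutator (unit_mat 0 1) g \<in> gl_fin"
    by (auto simp: twist_def pair_add sl_fin_def)
  then obtain N where "\<forall>i\<ge>N. \<forall>j. entry (commutator (unit_mat 0 1) g) i j = 0" by (auto simp: gl_fin_def)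
  then have "entry (commutator (unit_mat 0 1) g) (Suc N) 1 = 0" by simp
  then show False by (simp add: entry_commutator_unit g)
qed

theorem corollary3p6:
  "\<exists>(scale :: complex \<Rightarrow> (nat \<Rightarrow> nat \<Rightarrow> complex) \<Rightarrow> (nat \<Rightarrow> nat \<Rightarrow> complex)) q br l.
     finitary_lie_algebra scale q br \<and>
     lie_algebra.maximal_locally_semisimple scale q br l \<and>
     \<not> lie_algebra.levi_component scale q br l"
  using finitary_takiff maximal_sl_fin not_levi by blast

end
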